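(* Let $G$ be a $P\mathcal{M}$-factorizable topological group and let $f:G\to H$ be an open continuous homomorphism of $G$ onto a topological group $H$. Then $H$ is $P\mathcal{M}$-factorizable.
   Context: All topological spaces (in particular all topological groups) are assumed Hausdorff. A continuous map $f:X\to Y$ is perfect if it is closed, onto, and all fibers $f^{-1}(y)$ are compact; a perfect homomorphism is a continuous group homomorphism that is a perfect map. A topological group $G$ is $P\mathcal{M}$-factorizable if for every continuous function $f:G\to\mathbb{R}$ there are a perfect homomorphism $\pi:G\to H$ onto a metrizable topological group $H$ and a continuous function $g:H\to\mathbb{R}$ such that $f=g\circ\pi$. *)

theory Defs
  imports "HOL-Analysis.Analysis" "HOL-Algebra.Coset"
begin

text \<open>Topological groups are carrier-based and, by convention, Hausdorff.\<close>

locale topological_group = group G for G (structure) +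
  fixes T :: "'a topology"
  assumes topspace_eq_carrier: "topspace T = carrier G"
    and Hausdorff: "Hausdorff_space T"
    and continuous_mult: "continuous_map (prod_topology T T) T (\<lambda>(x, y). x \<otimes> y)"
    and continuous_inv: "continuous_map T T (\<lambda>x. inv x)"

definition perfect_hom ::
  "('a, 'm) monoid_scheme \<Rightarrow> 'a topology \<Rightarrow> ('b, 'n) monoid_scheme \<Rightarrow> 'b topology \<Rightarrow> ('a \<Rightarrow> 'b) \<Rightarrow> bool"
  where "perfect_hom G T H S \<pi> \<longleftrightarrow> \<pi> \<in> hom G H \<and> perfect_map T S \<pi>"

text \<open>
  HOL cannot quantify existentially over types, so the metrizable factor \<open>H\<close> is taken with
  elements of type \<open>'a set\<close>. This is no restriction: a homomorphic image of \<open>G\<close> is, up to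
  isomorphism, a group of cosets of \<open>G\<close>. Lemma \<open>PM_factorizableI\<close> below shows that factors
  over an arbitrary type suffice.
\<close>

definition PM_factorizable :: "('a, 'm) monoid_scheme \<Rightarrow> 'a topology \<Rightarrow> bool"
  where "PM_factorizable G T \<longleftrightarrow>
    topological_group G T \<and>
    (\<forall>f :: 'a \<Rightarrow> real. continuous_map T euclideanreal f \<longrightarrow>
      (\<exists>(H :: 'a set monoid) S \<pi> g.
        topological_group H S \<and> metrizable_space S \<and> perfect_hom G T H S \<pi> \<and>
        continuous_map S euclideanreal g \<and> (\<forall>x \<in> carrier G. f x = g (\<pi> x))))"

lemma PM_factorizableI:
  fixes G :: "('a, 'm) monoid_scheme" and T :: "'a topology"
  assumes G: "topological_group G T"
    and ex: "\<And>f :: 'a \<Rightarrow> real. continuous_map T euclideanreal f \<Longrightarrow>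
      \<exists>(H :: ('h, 'n) monoid_scheme) S \<pi> g.
        topological_group H S \<and> metrizable_space S \<and> perfect_hom G T H S \<pi> \<and>
        continuous_map S euclideanreal g \<and> (\<forall>x \<in> carrier G. f x = g (\<pi> x))"
  shows "PM_factorizable G T"
  unfolding PM_factorizable_def
proof (intro conjI allI impI)
  show "topological_group G T" by (fact G)
next
  fix f :: "'a \<Rightarrow> real" assume "continuous_map T euclideanreal f"
  from ex[OF this] obtain H :: "('h, 'n) monoid_scheme" and S \<pi> g where
    H: "topological_group H S" and S: "metrizable_space S" and \<pi>: "perfect_hom G T H S \<pi>"
    and g: "continuous_map S euclideanreal g" and fg: "\<forall>x \<in> carrier G. f x = g (\<pi> x)"
    by (elim exE conjE)
  interpret G: topological_group G T by (fact G)
  interpret H: topological_group H S by (fact H)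
  have onto: "\<pi> ` carrier G = carrier H"
    using \<pi> by (simp add: perfect_hom_def perfect_map_def G.topspace_eq_carrier H.topspace_eq_carrier)
  define \<phi> where "\<phi> h = {x \<in> carrier G. \<pi> x = h}" for h
  define \<psi> where "\<psi> = inv_into (carrier H) \<phi>"
  have inj: "inj_on \<phi> (carrier H)"
  proof (rule inj_onI)
    fix h k assume "h \<in> carrier H" and eq: "\<phi> h = \<phi> k"
    then obtain x where "x \<in> carrier G" "h = \<pi> x"
      using onto by (metis imageE)
    then have "x \<in> \<phi> h" by (simp add: \<phi>_def)
    then have "x \<in> \<phi> k" by (simp only: eq)
    with \<open>h = \<pi> x\<close> show "h = k" by (simp add: \<phi>_def)
  qed
  have \<psi>\<phi>[simp]: "\<psi> (\<phi> h) = h" if "h \<in> carrier H" for h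
    using inj that by (simp add: \<psi>_def)
  define K where "K = \<lparr>carrier = \<phi> ` carrier H, mult = (\<lambda>A B. \<phi> (\<psi> A \<otimes>\<^bsub>H\<^esub> \<psi> B)), one = \<phi> \<one>\<^bsub>H\<^esub>\<rparr>"
  have K_simps: "carrier K = \<phi> ` carrier H" "\<And>A B. A \<otimes>\<^bsub>K\<^esub> B = \<phi> (\<psi> A \<otimes>\<^bsub>H\<^esub> \<psi> B)" "\<one>\<^bsub>K\<^esub> = \<phi> \<one>\<^bsub>H\<^esub>"
    by (simp_all add: K_def)
  interpret K: group K
  proof (rule groupI)
    fix x assume "x \<in> carrier K"
    then obtain h where "h \<in> carrier H" "x = \<phi> h" by (auto simp: K_simps)
    then show "\<exists>y\<in>carrier K. y \<otimes>\<^bsub>K\<^esub> x = \<one>\<^bsub>K\<^esub>"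
      by (intro bexI[of _ "\<phi> (inv\<^bsub>H\<^esub> h)"]) (simp_all add: K_simps)
  qed (auto simp: K_simps H.m_assoc)
  have K_inv: "inv\<^bsub>K\<^esub> A = \<phi> (inv\<^bsub>H\<^esub> (\<psi> A))" if "A \<in> carrier K" for A
    by (rule K.inv_equality) (use that in \<open>auto simp: K_simps\<close>)
  define U where "U = pullback_topology (carrier K) \<psi> S"
  have topU: "topspace U = carrier K"
    by (auto simp: U_def topspace_pullback_topology K_simps H.topspace_eq_carrier)
  have c\<psi>: "continuous_map U S \<psi>"
    using continuous_map_pullback[of S S id "carrier K" \<psi>] by (simp add: U_def)
  have c\<phi>: "continuous_map S U \<phi>"
    unfolding U_def
  proof (rule continuous_map_pullback')
    show "continuous_map S S (\<psi> \<circ> \<phi>)"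
      by (rule continuous_map_eq[OF continuous_map_id]) (simp add: H.topspace_eq_carrier)
    show "topspace S \<subseteq> \<phi> -` carrier K"
      by (auto simp: K_simps H.topspace_eq_carrier)
  qed
  have hm: "homeomorphic_maps S U \<phi> \<psi>"
    using c\<phi> c\<psi> by (auto simp: homeomorphic_maps_def topU K_simps H.topspace_eq_carrier)
  have hs: "S homeomorphic_space U"
    using hm homeomorphic_space_def by blast
  have "topological_group K U"
  proof
    show "topspace U = carrier K" by (fact topU)
    show "Hausdorff_space U"
      using hs H.Hausdorff homeomorphic_Hausdorff_space by blast
    have "continuous_map (prod_topology U U) (prod_topology S S) (\<lambda>(x, y). (\<psi> x, \<psi> y))"
      using c\<psi> by (simp add: continuous_map_prod_top)
    from continuous_map_compose[OF continuous_map_compose[OF this H.continuous_mult] c\<phi>]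
    show "continuous_map (prod_topology U U) U (\<lambda>(x, y). x \<otimes>\<^bsub>K\<^esub> y)"
      by (rule continuous_map_eq) (auto simp: K_simps)
    from continuous_map_compose[OF continuous_map_compose[OF c\<psi> H.continuous_inv] c\<phi>]
    show "continuous_map U U (\<lambda>x. inv\<^bsub>K\<^esub> x)"
      by (rule continuous_map_eq) (auto simp: K_inv topU)
  qed
  moreover have "metrizable_space U"
    using hs S homeomorphic_metrizable_space by blast
  moreover have "perfect_hom G T K U (\<phi> \<circ> \<pi>)"
    unfolding perfect_hom_def
  proof
    have "\<phi> \<in> hom H K" by (rule homI) (auto simp: K_simps)
    then show "\<phi> \<circ> \<pi> \<in> hom G K" using \<pi> hom_compose unfolding perfect_hom_def by blast
    have "perfect_map S U \<phi>" using hm homeomorphic_imp_perfect_map homeomorphic_map_maps by blast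
    then show "perfect_map T U (\<phi> \<circ> \<pi>)" using \<pi> perfect_map_compose by (auto simp: perfect_hom_def)
  qed
  moreover have "continuous_map U euclideanreal (g \<circ> \<psi>)"
    using continuous_map_compose[OF c\<psi> g] .
  moreover have "\<forall>x \<in> carrier G. f x = (g \<circ> \<psi>) ((\<phi> \<circ> \<pi>) x)"
  proof
    fix x assume "x \<in> carrier G"
    then have "\<pi> x \<in> carrier H" using onto by blast
    with fg \<open>x \<in> carrier G\<close> show "f x = (g \<circ> \<psi>) ((\<phi> \<circ> \<pi>) x)" by simp
  qed
  ultimately show "\<exists>(H :: 'a set monoid) S \<pi> g.
        topological_group H S \<and> metrizable_space S \<and> perfect_hom G T H S \<pi> \<and>
        continuous_map S euclideanreal g \<and> (\<forall>x \<in> carrier G. f x = g (\<pi> x))"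
    by (intro exI conjI)
qed

end

theory Submission
  imports Defs
begin

text \<open>
  Let \<open>h\<close> be continuous on \<open>H\<close>, and let \<open>h \<circ> f\<close> factor through a perfect homomorphism
  \<open>\<pi> : G \<rightarrow> M\<close> with kernel \<open>K\<close>. Then \<open>N = f(K)\<close> is a compact normal subgroup of \<open>H\<close> and \<open>h\<close> is
  constant on its cosets, so the projection \<open>H \<rightarrow> H/N\<close> is a perfect homomorphism through which
  \<open>h\<close> factors. The open map \<open>G \<rightarrow> H \<rightarrow> H/N\<close> factors through \<open>\<pi>\<close>, which makes \<open>H/N\<close> an open
  continuous image of \<open>M\<close>. Hence \<open>H/N\<close> is first countable, and by the Birkhoff--Kakutani
  theorem it is metrizable.
\<close>

section \<open>The Birkhoff--Kakutani theorem\<close>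

text \<open>The pivot \<open>a\<close> is the entry at which the running sum reaches
  \<open>t\<close>. It is counted on neither side, so the part before it stays within
  \<open>t\<close> and the part after it within the remainder.\<close>

lemma sum_list_split_at:
  fixes xs :: "real list"
  assumes "xs \<noteq> []" "\<forall>x\<in>set xs. 0 \<le> x" "0 \<le> t" "t \<le> sum_list xs"
  shows "\<exists>ys a zs. xs = ys @ a # zs \<and> sum_list ys \<le> t \<and> sum_list zs \<le> sum_list xs - t"
  using assms
proof (induction xs arbitrary: t)
  case (Cons a r)
  show ?case
  proof (cases "t \<le> a")
    case True
    then show ?thesis by (intro exI[of _ "[]"] exI[of _ a] exI[of _ r]) (use Cons in auto)
  next
    case False
    then have "r \<noteq> []" using Cons by auto
    then have "\<exists>ys b zs. r = ys @ b # zs \<and> sum_list ys \<le> t - a \<and> sum_list zs \<le> sum_list r - (t - a)"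
      by (intro Cons.IH) (use Cons.prems False in auto)
    then obtain ys b zs where "r = ys @ b # zs" "sum_list ys \<le> t - a" "sum_list zs \<le> sum_list r - (t - a)"
      by blast
    then show ?thesis by (intro exI[of _ "a # ys"] exI[of _ b] exI[of _ zs]) auto
  qed
qed simp

section \<open>Chains, group norms and left-invariant metrics\<close>

context group
begin

abbreviation list_mult :: "'a list \<Rightarrow> 'a" where
  "list_mult xs \<equiv> foldr (\<otimes>) xs \<one>"

lemma list_mult_closed [simp]: "set xs \<subseteq> carrier G \<Longrightarrow> list_mult xs \<in> carrier G"
  by (induction xs) auto

lemma list_mult_append:
  "set xs \<subseteq> carrier G \<Longrightarrow> set ys \<subseteq> carrier G \<Longrightarrow> list_mult (xs @ ys) = list_mult xs \<otimes> list_mult ys"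
  by (induction xs) (auto simp: m_assoc simp del: foldr_append)

lemma list_mult_inv:
  "set xs \<subseteq> carrier G \<Longrightarrow> list_mult (map (\<lambda>x. inv x) (rev xs)) = inv (list_mult xs)"
proof (induction xs)
  case (Cons a xs)
  have "set (map (\<lambda>x. inv x) (rev xs)) \<subseteq> carrier G" using Cons.prems by auto
  then have "list_mult (map (\<lambda>x. inv x) (rev (a # xs))) = list_mult (map (\<lambda>x. inv x) (rev xs)) \<otimes> list_mult [inv a]"
    using Cons.prems list_mult_append[of "map (\<lambda>x. inv x) (rev xs)" "[inv a]"] by simp
  then show ?case using Cons by (simp add: inv_mult_group)
qed simp

text \<open>Splitting a chain at the factor where the running weight passes one half of the total leaves
  two shorter chains of at most half the weight.\<close>

lemma weight_list_mult_le:
  fixes v :: "'a \<Rightarrow> real"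
  assumes nonneg: "\<And>x. 0 \<le> v x" and one: "v \<one> = 0"
    and triple: "\<And>x y z e. \<lbrakk>x \<in> carrier G; y \<in> carrier G; z \<in> carrier G; v x \<le> e; v y \<le> e; v z \<le> e\<rbrakk>
      \<Longrightarrow> v (x \<otimes> y \<otimes> z) \<le> 2 * e"
    and "set xs \<subseteq> carrier G"
  shows "v (list_mult xs) \<le> 2 * sum_list (map v xs)"
  using \<open>set xs \<subseteq> carrier G\<close>
proof (induction xs rule: length_induct)
  case (1 xs)
  let ?s = "sum_list (map v xs)"
  have s: "0 \<le> ?s" by (rule sum_list_nonneg) (use nonneg in auto)
  show ?case
  proof (cases "xs = []")
    case False
    have "\<exists>ys a zs. map v xs = ys @ a # zs \<and> sum_list ys \<le> ?s / 2 \<and> sum_list zs \<le> ?s - ?s / 2"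
      by (rule sum_list_split_at) (use nonneg s False in auto)
    then obtain ys a zs where xs: "xs = ys @ a # zs"
      and "sum_list (map v ys) \<le> ?s / 2" "sum_list (map v zs) \<le> ?s / 2"
      by (auto simp: map_eq_append_conv map_eq_Cons_conv)
    moreover have "v (list_mult ys) \<le> 2 * sum_list (map v ys)" "v (list_mult zs) \<le> 2 * sum_list (map v zs)"
      using 1 xs by auto
    moreover have "0 \<le> sum_list (map v ys)" "0 \<le> sum_list (map v zs)"
      by (rule sum_list_nonneg, use nonneg in auto)+
    \<comment> \<open>The induction hypothesis doubles at most half of \<open>?s\<close>, so both
      outer products have weight at most \<open>?s\<close>; the middle factor is a single summand of
      \<open>?s\<close>. Applying \<open>triple\<close> with \<open>e = ?s\<close> then gives
      exactly the factor 2 of the claim.\<close>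
    ultimately have "v (list_mult ys) \<le> ?s" "v a \<le> ?s" "v (list_mult zs) \<le> ?s"
      by auto
    moreover have "list_mult xs = list_mult ys \<otimes> a \<otimes> list_mult zs"
      using 1 xs list_mult_append[of ys "a # zs"] by (simp add: m_assoc del: foldr_append)
    ultimately show ?thesis using triple[of "list_mult ys" a "list_mult zs" ?s] 1 xs by auto
  qed (simp add: one)
qed

text \<open>The norm of \<open>x\<close> is the infimum of the total weights of all chains with
  product \<open>x\<close>. One-element chains give \<open>p x \<le> v x\<close>, the preceding
  bound on chains gives \<open>v x \<le> 2 * p x\<close>, concatenation gives subadditivity, and
  reversing and inverting chains gives symmetry.\<close>

lemma group_norm_of_weight:
  fixes v :: "'a \<Rightarrow> real"
  assumes nonneg: "\<And>x. 0 \<le> v x" and one: "v \<one> = 0"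
    and triple: "\<And>x y z e. \<lbrakk>x \<in> carrier G; y \<in> carrier G; z \<in> carrier G; v x \<le> e; v y \<le> e; v z \<le> e\<rbrakk>
      \<Longrightarrow> v (x \<otimes> y \<otimes> z) \<le> 2 * e"
    and sym: "\<And>x. x \<in> carrier G \<Longrightarrow> v (inv x) = v x"
  obtains p :: "'a \<Rightarrow> real" where
    "\<And>x. x \<in> carrier G \<Longrightarrow> p x \<le> v x" "\<And>x. x \<in> carrier G \<Longrightarrow> v x \<le> 2 * p x"
    "\<And>x y. \<lbrakk>x \<in> carrier G; y \<in> carrier G\<rbrakk> \<Longrightarrow> p (x \<otimes> y) \<le> p x + p y"
    "\<And>x. x \<in> carrier G \<Longrightarrow> p (inv x) = p x"
proof -
  define C where "C x = {xs. set xs \<subseteq> carrier G \<and> list_mult xs = x}" for x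
  define w where "w xs = sum_list (map v xs)" for xs
  define p where "p x = Inf (w ` C x)" for x
  have w0: "0 \<le> w xs" for xs unfolding w_def by (rule sum_list_nonneg) (use nonneg in auto)
  then have bdd: "bdd_below (w ` C x)" for x by (intro bdd_belowI[of _ 0]) auto
  have single: "[x] \<in> C x" if "x \<in> carrier G" for x using that by (auto simp: C_def)
  have p_le: "p x \<le> w xs" if "xs \<in> C x" for x xs
    unfolding p_def using bdd that by (simp add: cInf_lower)
  have le_p: "c \<le> p x" if "x \<in> carrier G" "\<And>xs. xs \<in> C x \<Longrightarrow> c \<le> w xs" for x c
    unfolding p_def by (rule cInf_greatest) (use single that in auto)
  have p_inv: "p (inv x) \<le> p x" if "x \<in> carrier G" for x
  proof (rule le_p[OF that])
    fix xs assume xs: "xs \<in> C x"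
    then have "map (\<lambda>x. inv x) (rev xs) \<in> C (inv x)"
      using list_mult_inv by (auto simp: C_def)
    moreover have "map v (map (\<lambda>x. inv x) (rev xs)) = rev (map v xs)"
      using xs sym by (auto simp: C_def rev_map)
    then have "w (map (\<lambda>x. inv x) (rev xs)) = w xs"
      by (metis w_def sum_list_rev)
    ultimately show "p (inv x) \<le> w xs" using p_le by metis
  qed
  show thesis
  proof (rule that)
    show "p x \<le> v x" if "x \<in> carrier G" for x
      using p_le[OF single[OF that]] by (simp add: w_def)
    show "v x \<le> 2 * p x" if "x \<in> carrier G" for x
    proof -
      have "v x / 2 \<le> w xs" if "xs \<in> C x" for xs
        using weight_list_mult_le[of v xs] assms that by (simp add: C_def w_def)
      from le_p[OF that this] show ?thesis by simp
    qed
    show "p (x \<otimes> y) \<le> p x + p y" if x: "x \<in> carrier G" and y: "y \<in> carrier G" for x y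
    proof -
      \<comment> \<open>The infimum is taken in two stages: first over the chains for
        \<open>x\<close> with \<open>ys\<close> fixed, then over the chains for
        \<open>y\<close>.\<close>
      have "p (x \<otimes> y) - w ys \<le> w xs" if "xs \<in> C x" "ys \<in> C y" for xs ys
      proof -
        have "xs @ ys \<in> C (x \<otimes> y)"
          using that list_mult_append[of xs ys] by (auto simp: C_def simp del: foldr_append)
        from p_le[OF this] show ?thesis by (simp add: w_def)
      qed
      then have "p (x \<otimes> y) - p x \<le> w ys" if "ys \<in> C y" for ys
        using le_p[OF x, of "p (x \<otimes> y) - w ys"] that by fastforce
      from le_p[OF y this] show ?thesis by simp
    qed
    show "p (inv x) = p x" if "x \<in> carrier G" for x
      using p_inv[OF that] p_inv[of "inv x"] that by simp
  qed
qed

text \<open>The distance is left-invariant, and its triangle inequality is subadditivity of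
  \<open>p\<close> on the product of \<open>inv x \<otimes> y\<close> and
  \<open>inv y \<otimes> z\<close>. The default value 0 off the carrier is chosen because
  \<open>Metric_space\<close> demands nonnegativity and symmetry for all elements of the
  type.\<close>

lemma metric_of_group_norm:
  fixes p :: "'a \<Rightarrow> real"
  assumes zero: "\<And>x. x \<in> carrier G \<Longrightarrow> p x = 0 \<longleftrightarrow> x = \<one>"
    and nonneg: "\<And>x. x \<in> carrier G \<Longrightarrow> 0 \<le> p x"
    and sub: "\<And>x y. \<lbrakk>x \<in> carrier G; y \<in> carrier G\<rbrakk> \<Longrightarrow> p (x \<otimes> y) \<le> p x + p y"
    and inv: "\<And>x. x \<in> carrier G \<Longrightarrow> p (inv x) = p x"
  shows "Metric_space (carrier G) (\<lambda>x y. if x \<in> carrier G \<and> y \<in> carrier G then p (inv x \<otimes> y) else 0)"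
proof
  fix x y z assume xyz: "x \<in> carrier G" "y \<in> carrier G" "z \<in> carrier G"
  have "y \<otimes> (inv y \<otimes> z) = z" using xyz by (simp add: m_assoc[symmetric])
  then have "inv x \<otimes> z = (inv x \<otimes> y) \<otimes> (inv y \<otimes> z)"
    using xyz by (simp add: m_assoc)
  then show "(if x \<in> carrier G \<and> z \<in> carrier G then p (inv x \<otimes> z) else 0)
      \<le> (if x \<in> carrier G \<and> y \<in> carrier G then p (inv x \<otimes> y) else 0) +
        (if y \<in> carrier G \<and> z \<in> carrier G then p (inv y \<otimes> z) else 0)"
    using sub[of "inv x \<otimes> y" "inv y \<otimes> z"] xyz by simp
next
  fix x y assume xy: "x \<in> carrier G" "y \<in> carrier G"
  then have "inv x \<otimes> y = \<one> \<longleftrightarrow> x = y"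
    by (metis inv_closed inv_equality inv_inv l_inv)
  then show "(if x \<in> carrier G \<and> y \<in> carrier G then p (inv x \<otimes> y) else 0) = 0 \<longleftrightarrow> x = y"
    using xy zero by simp
next
  fix x y
  have "p (inv x \<otimes> y) = p (inv y \<otimes> x)" if "x \<in> carrier G" "y \<in> carrier G"
    using inv[of "inv x \<otimes> y"] that by (simp add: inv_mult_group)
  then show "(if x \<in> carrier G \<and> y \<in> carrier G then p (inv x \<otimes> y) else 0) =
      (if y \<in> carrier G \<and> x \<in> carrier G then p (inv y \<otimes> x) else 0)"
    by auto
qed (use nonneg in auto)

end

section \<open>Neighbourhoods of the identity and metrizability\<close>

context topological_group
begin

lemma continuous_map_mult:
  assumes "continuous_map X T g" "continuous_map X T h"
  shows "continuous_map X T (\<lambda>x. g x \<otimes> h x)"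
proof -
  have "continuous_map X (prod_topology T T) (\<lambda>x. (g x, h x))"
    using assms by (simp add: continuous_map_pairedI)
  from continuous_map_compose[OF this continuous_mult] show ?thesis by (simp add: o_def)
qed

lemma openin_translate:
  assumes "a \<in> carrier G" "openin T U"
  shows "openin T {y \<in> carrier G. a \<otimes> y \<in> U}"
proof -
  have "continuous_map T T (\<lambda>y. a \<otimes> y)"
    by (rule continuous_map_mult) (use assms in \<open>auto simp: topspace_eq_carrier\<close>)
  from openin_continuous_map_preimage[OF this assms(2)] show ?thesis
    by (simp add: topspace_eq_carrier)
qed

text \<open>Continuity of multiplication at the identity, used twice, yields \<open>B\<close> with
  products in \<open>A\<close>, and \<open>A\<close> with products in \<open>W\<close>. The third
  factor has to lie in \<open>A\<close>, hence the intersection \<open>D\<close>; intersecting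
  \<open>D\<close> with its preimage under inversion makes it symmetric.\<close>

lemma symmetric_neighbourhood:
  assumes "openin T W" "\<one> \<in> W"
  obtains V where "openin T V" "\<one> \<in> V" "\<And>x. x \<in> V \<Longrightarrow> inv x \<in> V"
    "\<And>x y z. \<lbrakk>x \<in> V; y \<in> V; z \<in> V\<rbrakk> \<Longrightarrow> x \<otimes> y \<otimes> z \<in> W"
proof -
  have half: "\<exists>V. openin T V \<and> \<one> \<in> V \<and> (\<forall>x\<in>V. \<forall>y\<in>V. x \<otimes> y \<in> W)" if W: "openin T W" "\<one> \<in> W" for W
  proof -
    define Z where "Z = {z \<in> topspace (prod_topology T T). (\<lambda>(x, y). x \<otimes> y) z \<in> W}"
    have "openin (prod_topology T T) Z"
      unfolding Z_def using openin_continuous_map_preimage[OF continuous_mult W(1)] .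
    moreover have "(\<one>, \<one>) \<in> Z" using W(2) by (simp add: Z_def topspace_eq_carrier)
    ultimately obtain A B where "openin T A" "openin T B" "\<one> \<in> A" "\<one> \<in> B" "A \<times> B \<subseteq> Z"
      unfolding openin_prod_topology_alt by metis
    moreover have "x \<otimes> y \<in> W" if "(x, y) \<in> Z" for x y using that by (simp add: Z_def)
    ultimately
    show ?thesis by (intro exI[of _ "A \<inter> B"]) auto
  qed
  obtain A where A: "openin T A" "\<one> \<in> A" "\<And>x y. x \<in> A \<Longrightarrow> y \<in> A \<Longrightarrow> x \<otimes> y \<in> W"
    using half[OF assms] by blast
  obtain B where B: "openin T B" "\<one> \<in> B" "\<And>x y. x \<in> B \<Longrightarrow> y \<in> B \<Longrightarrow> x \<otimes> y \<in> A"
    using half[OF A(1,2)] by blast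
  define D where "D = A \<inter> B"
  have D: "openin T D" "\<one> \<in> D" "D \<subseteq> carrier G"
    using A(1,2) B(1,2) openin_subset[OF A(1)] by (auto simp: D_def topspace_eq_carrier)
  define V where "V = D \<inter> {x \<in> carrier G. inv x \<in> D}"
  show thesis
  proof
    have "openin T {x \<in> topspace T. inv x \<in> D}"
      by (rule openin_continuous_map_preimage[OF continuous_inv D(1)])
    then show "openin T V" using D(1) by (auto simp: V_def topspace_eq_carrier)
    show "x \<otimes> y \<otimes> z \<in> W" if "x \<in> V" "y \<in> V" "z \<in> V" for x y z
      using that A(3)[OF B(3)] by (auto simp: V_def D_def)
  qed (use D in \<open>auto simp: V_def\<close>)
qed

text \<open>A countable base at the identity is refined to symmetric neighbourhoods
  \<open>U n\<close>, each containing all threefold products from the next. The depth of a point in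
  this sequence is a weight satisfying the hypotheses of \<open>group_norm_of_weight\<close>; the
  resulting left-invariant metric induces \<open>T\<close> because the norm and the weight agree up
  to a factor 2.\<close>

theorem first_countable_imp_metrizable:
  assumes "first_countable T"
  shows "metrizable_space T"
proof -
  have "\<one> \<in> topspace T" by (simp add: topspace_eq_carrier)
  then obtain \<B> where \<B>: "countable \<B>" "\<And>V. V \<in> \<B> \<Longrightarrow> openin T V"
    "\<And>U. openin T U \<Longrightarrow> \<one> \<in> U \<Longrightarrow> \<exists>V\<in>\<B>. \<one> \<in> V \<and> V \<subseteq> U"
    using assms unfolding first_countable_def by meson
  define \<C> where "\<C> = {V \<in> \<B>. \<one> \<in> V}"
  have "\<C> \<noteq> {}" using \<B>(3)[of "topspace T"] \<open>\<one> \<in> topspace T\<close> by (auto simp: \<C>_def)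
  moreover have "countable \<C>" using \<B>(1) by (simp add: \<C>_def)
  ultimately obtain B :: "nat \<Rightarrow> 'a set" where "range B = \<C>"
    by (metis range_from_nat_into)
  then have B: "openin T (B n)" "\<one> \<in> B n" for n
  proof -
    have "B n \<in> \<C>" using \<open>range B = \<C>\<close> by blast
    then show "openin T (B n)" "\<one> \<in> B n" using \<B>(2) by (auto simp: \<C>_def)
  qed
  have B_base: "\<exists>n. B n \<subseteq> W" if "openin T W" "\<one> \<in> W" for W
  proof -
    from \<B>(3)[OF that] obtain V where "V \<in> \<B>" "\<one> \<in> V" "V \<subseteq> W" by blast
    then have "V \<in> range B" using \<open>range B = \<C>\<close> by (simp add: \<C>_def)
    then show ?thesis using \<open>V \<subseteq> W\<close> by blast
  qed
  define P where "P n V \<longleftrightarrow> openin T V \<and> \<one> \<in> V \<and> (\<forall>x\<in>V. inv x \<in> V) \<and> (n = 0 \<longrightarrow> V = carrier G)"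
    for n :: nat and V
  \<comment> \<open>Requiring products to lie in \<open>B n\<close> as well makes the chosen sets a
    neighbourhood base at the identity.\<close>
  define R where "R n W V \<longleftrightarrow> (\<forall>x\<in>V. \<forall>y\<in>V. \<forall>z\<in>V. x \<otimes> y \<otimes> z \<in> W \<inter> B n)" for n W V
  have "\<exists>U. \<forall>n. P n (U n) \<and> R n (U n) (U (Suc n))"
  proof (rule dependent_nat_choice)
    show "\<exists>V. P 0 V"
      by (rule exI[of _ "carrier G"]) (simp add: P_def flip: topspace_eq_carrier, simp add: topspace_eq_carrier)
    fix W n assume "P n W"
    then have "openin T (W \<inter> B n)" "\<one> \<in> W \<inter> B n" using B by (auto simp: P_def)
    from symmetric_neighbourhood[OF this] obtain V where "openin T V" "\<one> \<in> V" "\<And>x. x \<in> V \<Longrightarrow> inv x \<in> V"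
      "\<And>x y z. \<lbrakk>x \<in> V; y \<in> V; z \<in> V\<rbrakk> \<Longrightarrow> x \<otimes> y \<otimes> z \<in> W \<inter> B n"
      by metis
    then show "\<exists>V. P (Suc n) V \<and> R n W V" by (intro exI[of _ V]) (simp add: P_def R_def)
  qed
  then obtain U where PU: "\<And>n. P n (U n)" and RU: "\<And>n. R n (U n) (U (Suc n))" by blast
  have U: "openin T (U n)" "\<one> \<in> U n" "x \<in> U n \<Longrightarrow> inv x \<in> U n" "U 0 = carrier G" for n x
    using PU[of n] PU[of 0] by (auto simp: P_def)
  have U_sub: "U n \<subseteq> carrier G" for n using openin_subset[OF U(1)] by (simp add: topspace_eq_carrier)
  have U_triple: "x \<otimes> y \<otimes> z \<in> U n" "x \<otimes> y \<otimes> z \<in> B n" if "x \<in> U (Suc n)" "y \<in> U (Suc n)" "z \<in> U (Suc n)" for x y z n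
    using RU[of n] that by (auto simp: R_def)
  have U_Suc: "U (Suc n) \<subseteq> U n \<inter> B n" for n
  proof
    fix x assume x: "x \<in> U (Suc n)"
    then have "x \<in> carrier G" using U_sub by blast
    then show "x \<in> U n \<inter> B n" using U_triple[OF x U(2) U(2)] by simp
  qed
  have U_antimono: "U n \<subseteq> U m" if "m \<le> n" for m n
    using lift_Suc_antimono_le[of U, OF _ that] U_Suc by blast
  have U_base: "\<exists>n. U n \<subseteq> W" if "openin T W" "\<one> \<in> W" for W
    using B_base[OF that] U_Suc by (metis le_inf_iff subset_trans)
  have U_Inter: "x = \<one>" if "\<And>n. x \<in> U n" for x
  proof (rule ccontr)
    assume ne: "x \<noteq> \<one>"
    have "x \<in> topspace T" using that U_sub topspace_eq_carrier by blast
    then obtain W where "openin T W" "\<one> \<in> W" "x \<notin> W"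
      using Hausdorff ne \<open>\<one> \<in> topspace T\<close> unfolding Hausdorff_space_def disjnt_iff by metis
    then show False using U_base that by blast
  qed
  \<comment> \<open>The exponent is the first index whose set omits \<open>x\<close>, so membership
    in \<open>U n\<close> corresponds to the strict inequality \<open>v x < (1/2) ^ n\<close>.
    Points in every \<open>U n\<close> get weight 0; by the Hausdorff property this is the identity
    alone.\<close>
  define v :: "'a \<Rightarrow> real" where "v x = (if \<forall>n. x \<in> U n then 0 else (1/2) ^ (LEAST n. x \<notin> U n))" for x
  have v_less: "v x < (1/2) ^ n \<longleftrightarrow> x \<in> U n" for x n
  proof (cases "\<forall>n. x \<in> U n")
    case False
    define k where "k = (LEAST n. x \<notin> U n)"
    have k: "x \<notin> U k" unfolding k_def using False by (metis (mono_tags, lifting) LeastI)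
    have "x \<in> U n \<longleftrightarrow> n < k"
    proof
      show "x \<in> U n \<Longrightarrow> n < k" using k U_antimono by (metis not_less subsetD)
      show "n < k \<Longrightarrow> x \<in> U n" unfolding k_def using not_less_Least by blast
    qed
    moreover have "v x = (1/2) ^ k" using False by (auto simp: v_def k_def)
    ultimately show ?thesis by (simp add: power_strict_decreasing_iff)
  qed (simp add: v_def)
  have v_nonneg: "0 \<le> v x" for x by (simp add: v_def)
  have v_triple: "v (x \<otimes> y \<otimes> z) \<le> 2 * e" if c: "x \<in> carrier G" "y \<in> carrier G" "z \<in> carrier G"
    and e: "v x \<le> e" "v y \<le> e" "v z \<le> e" for x y z e
  proof (rule ccontr)
    assume "\<not> v (x \<otimes> y \<otimes> z) \<le> 2 * e"
    moreover have "0 \<le> e" using e(1) v_nonneg[of x] by simp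
    \<comment> \<open>The weight of the product exceeds \<open>2 * e\<close> and so is positive,
      hence a power of 1/2. Then \<open>e\<close> lies below the next power, which puts all three
      factors in \<open>U (Suc k)\<close> and their product in \<open>U k\<close>, a
      contradiction.\<close>
    ultimately obtain k where k: "v (x \<otimes> y \<otimes> z) = (1/2) ^ k" by (auto simp: v_def split: if_splits)
    then have "e < (1/2) ^ Suc k" using \<open>\<not> v (x \<otimes> y \<otimes> z) \<le> 2 * e\<close> by simp
    then have "x \<in> U (Suc k)" "y \<in> U (Suc k)" "z \<in> U (Suc k)"
      using e v_less[of x "Suc k"] v_less[of y "Suc k"] v_less[of z "Suc k"] by linarith+
    from U_triple(1)[OF this] have "v (x \<otimes> y \<otimes> z) < (1/2) ^ k" using v_less by blast
    then show False using k by simp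
  qed
  have inv_U: "inv x \<in> U n \<longleftrightarrow> x \<in> U n" if "x \<in> carrier G" for x n
    using U(3)[of x n] U(3)[of "inv x" n] that by auto
  have v_inv: "v (inv x) = v x" if "x \<in> carrier G" for x
    using inv_U[OF that] by (simp add: v_def)
  have v_zero: "v x = 0 \<longleftrightarrow> x = \<one>" for x using U(2) U_Inter by (auto simp: v_def)
  obtain p where p: "\<And>x. x \<in> carrier G \<Longrightarrow> p x \<le> v x" "\<And>x. x \<in> carrier G \<Longrightarrow> v x \<le> 2 * p x"
    "\<And>x y. \<lbrakk>x \<in> carrier G; y \<in> carrier G\<rbrakk> \<Longrightarrow> p (x \<otimes> y) \<le> p x + p y"
    "\<And>x. x \<in> carrier G \<Longrightarrow> p (inv x) = p x"
    using group_norm_of_weight[OF v_nonneg v_zero[THEN iffD2, OF refl] v_triple v_inv] by blast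
  define d where "d x y = (if x \<in> carrier G \<and> y \<in> carrier G then p (inv x \<otimes> y) else 0)" for x y
  have p_nonneg: "0 \<le> p x" if "x \<in> carrier G" for x using p(2)[OF that] v_nonneg[of x] by linarith
  have p_zero: "p x = 0 \<longleftrightarrow> x = \<one>" if "x \<in> carrier G" for x
    using p(1,2)[OF that] v_nonneg[of x] p_nonneg[OF that] v_zero[of x] by auto
  interpret M: Metric_space "carrier G" d
    using metric_of_group_norm[OF p_zero p_nonneg p(3,4)] unfolding d_def[abs_def] by blast
  have translate: "inv a \<otimes> (a \<otimes> y) = y" "a \<otimes> (inv a \<otimes> y) = y" if "a \<in> carrier G" "y \<in> carrier G" for a y
    using that by (simp_all add: m_assoc[symmetric])
  have "openin T W \<longleftrightarrow> openin M.mtopology W" for W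
  proof
    assume W: "openin T W"
    have WG: "W \<subseteq> carrier G" using openin_subset[OF W] by (simp add: topspace_eq_carrier)
    show "openin M.mtopology W"
      unfolding M.openin_mtopology
    proof (intro conjI allI impI)
      fix x assume x: "x \<in> W"
      then have xG: "x \<in> carrier G" using WG by blast
      have "openin T {y \<in> carrier G. x \<otimes> y \<in> W}" "\<one> \<in> {y \<in> carrier G. x \<otimes> y \<in> W}"
        using openin_translate[OF xG W] x xG by auto
      from U_base[OF this] obtain n where n: "U n \<subseteq> {y \<in> carrier G. x \<otimes> y \<in> W}" by blast
      \<comment> \<open>The extra halving of the radius absorbs the factor 2 in
        \<open>v x \<le> 2 * p x\<close>.\<close>
      have "M.mball x ((1/2) ^ Suc n) \<subseteq> W"
      proof
        fix y assume "y \<in> M.mball x ((1/2) ^ Suc n)"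
        then have y: "y \<in> carrier G" and "p (inv x \<otimes> y) < (1/2) ^ Suc n" using xG by (auto simp: d_def)
        then have "v (inv x \<otimes> y) < (1/2) ^ n" using p(2)[of "inv x \<otimes> y"] xG by simp
        then have "x \<otimes> (inv x \<otimes> y) \<in> W" using n v_less by blast
        then show "y \<in> W" using translate(2)[OF xG y] by simp
      qed
      then show "\<exists>r>0. M.mball x r \<subseteq> W" by (intro exI[of _ "(1/2) ^ Suc n"]) simp
    qed (fact WG)
  next
    assume W: "openin M.mtopology W"
    show "openin T W"
    proof (subst openin_subopen, intro ballI)
      fix x assume x: "x \<in> W"
      obtain r where r: "r > 0" "M.mball x r \<subseteq> W" and xG: "x \<in> carrier G"
        using W x unfolding M.openin_mtopology by blast
      obtain n where n: "(1/2) ^ n < r" using real_arch_pow_inv[OF r(1), of "1/2"] by auto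
      \<comment> \<open>The left translate of \<open>U n\<close> by \<open>x\<close>. It lies in the
        ball of radius \<open>r\<close> since \<open>p\<close> is bounded by
        \<open>v\<close>.\<close>
      define A where "A = {y \<in> carrier G. inv x \<otimes> y \<in> U n}"
      have "openin T A" unfolding A_def by (rule openin_translate) (use xG U in auto)
      moreover have "x \<in> A" using xG U by (simp add: A_def)
      moreover have "A \<subseteq> W"
      proof
        fix y assume "y \<in> A"
        then have y: "y \<in> carrier G" "v (inv x \<otimes> y) < (1/2) ^ n" using v_less by (auto simp: A_def)
        then have "p (inv x \<otimes> y) < r" using p(1)[of "inv x \<otimes> y"] xG n by simp
        then show "y \<in> W" using r xG y by (auto simp: d_def)
      qed
      ultimately show "\<exists>A. openin T A \<and> x \<in> A \<and> A \<subseteq> W" by blast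
    qed
  qed
  then have "T = M.mtopology" by (simp add: topology_eq)
  then show ?thesis using M.metrizable_space_mtopology by simp
qed

end

section \<open>Quotients by compact normal subgroups\<close>

text \<open>The final topology for \<open>q\<close>. Confining open sets to the image makes that
  image the underlying space, so that for the coset projection it is the carrier of the factor
  group.\<close>

definition quotient_topology :: "'a topology \<Rightarrow> ('a \<Rightarrow> 'b) \<Rightarrow> 'b topology" where
  "quotient_topology X q = topology (\<lambda>U. U \<subseteq> q ` topspace X \<and> openin X {x \<in> topspace X. q x \<in> U})"

lemma openin_quotient_topology:
  "openin (quotient_topology X q) U \<longleftrightarrow> U \<subseteq> q ` topspace X \<and> openin X {x \<in> topspace X. q x \<in> U}"
proof -
  have "istopology (\<lambda>U. U \<subseteq> q ` topspace X \<and> openin X {x \<in> topspace X. q x \<in> U})"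
    unfolding istopology_def
  proof (intro conjI allI impI)
    fix A B assume A: "A \<subseteq> q ` topspace X \<and> openin X {x \<in> topspace X. q x \<in> A}"
      and B: "B \<subseteq> q ` topspace X \<and> openin X {x \<in> topspace X. q x \<in> B}"
    have "{x \<in> topspace X. q x \<in> A \<inter> B} = {x \<in> topspace X. q x \<in> A} \<inter> {x \<in> topspace X. q x \<in> B}" by auto
    also have "openin X \<dots>" using A B by (intro openin_Int) auto
    finally show "openin X {x \<in> topspace X. q x \<in> A \<inter> B}" .
    show "A \<inter> B \<subseteq> q ` topspace X" using A by blast
  next
    fix \<K> assume K: "\<forall>A\<in>\<K>. A \<subseteq> q ` topspace X \<and> openin X {x \<in> topspace X. q x \<in> A}"
    have "{x \<in> topspace X. q x \<in> \<Union>\<K>} = (\<Union>A\<in>\<K>. {x \<in> topspace X. q x \<in> A})" by auto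
    then show "openin X {x \<in> topspace X. q x \<in> \<Union>\<K>}" using K by auto
    show "\<Union>\<K> \<subseteq> q ` topspace X" using K by blast
  qed
  then show ?thesis by (simp add: quotient_topology_def)
qed

lemma topspace_quotient_topology [simp]: "topspace (quotient_topology X q) = q ` topspace X"
proof (rule antisym)
  show "topspace (quotient_topology X q) \<subseteq> q ` topspace X"
    using openin_quotient_topology openin_topspace by metis
  have "{x \<in> topspace X. q x \<in> q ` topspace X} = topspace X" by auto
  then have "openin (quotient_topology X q) (q ` topspace X)" by (simp add: openin_quotient_topology)
  then show "q ` topspace X \<subseteq> topspace (quotient_topology X q)" by (rule openin_subset)
qed

lemma quotient_map_quotient_topology: "quotient_map X (quotient_topology X q) q"
  by (auto simp: quotient_map_def openin_quotient_topology)

text \<open>A product of quotient maps need not be a quotient map, but a product of open maps is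
  open. This is what lets multiplication descend to the coset space.\<close>

lemma open_map_map_prod:
  assumes f: "open_map X X' f" and g: "open_map Y Y' g"
  shows "open_map (prod_topology X Y) (prod_topology X' Y') (\<lambda>(x, y). (f x, g y))"
  unfolding open_map_def
proof (intro allI impI)
  fix W assume W: "openin (prod_topology X Y) W"
  show "openin (prod_topology X' Y') ((\<lambda>(x, y). (f x, g y)) ` W)"
    unfolding openin_prod_topology_alt
  proof (intro allI impI)
    fix a b assume "(a, b) \<in> (\<lambda>(x, y). (f x, g y)) ` W"
    then obtain x y where xy: "(x, y) \<in> W" "a = f x" "b = g y" by auto
    then obtain U V where "openin X U" "openin Y V" "x \<in> U" "y \<in> V" "U \<times> V \<subseteq> W"
      using W unfolding openin_prod_topology_alt by metis
    then show "\<exists>U V. openin X' U \<and> openin Y' V \<and> a \<in> U \<and> b \<in> V \<and> U \<times> V \<subseteq> (\<lambda>(x, y). (f x, g y)) ` W"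
      using f g xy by (intro exI[of _ "f ` U"] exI[of _ "g ` V"]) (force simp: open_map_def)
  qed
qed

section \<open>The coset projection and the factor group\<close>

locale compact_normal_subgroup = topological_group G T + normal N G for G (structure) and T and N +
  assumes compact: "compactin T N"
begin

abbreviation "proj \<equiv> \<lambda>a. N #> a"

abbreviation "quot_top \<equiv> quotient_topology T proj"

lemma proj_eq_iff:
  assumes "x \<in> carrier G" "y \<in> carrier G"
  shows "N #> x = N #> y \<longleftrightarrow> (\<exists>n\<in>N. x = n \<otimes> y)"
proof
  assume "N #> x = N #> y"
  then have "x \<in> N #> y" using rcos_self[OF assms(1)] is_subgroup by auto
  then show "\<exists>n\<in>N. x = n \<otimes> y" by (auto simp: r_coset_def)
next
  assume "\<exists>n\<in>N. x = n \<otimes> y"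
  then have "x \<in> N #> y" by (auto simp: r_coset_def)
  then show "N #> x = N #> y" using repr_independence assms is_subgroup by metis
qed

lemma topspace_quot_top: "topspace quot_top = carrier (G Mod N)"
  by (simp add: topspace_eq_carrier carrier_FactGroup)

text \<open>This form of the saturation serves two purposes: it is a union of preimages of
  \<open>A\<close> under left translations, which settles openness, and a projection along
  \<open>N\<close>, which settles closedness.\<close>

lemma proj_saturation:
  assumes "A \<subseteq> carrier G"
  shows "{x \<in> topspace T. N #> x \<in> proj ` A} = {x \<in> carrier G. \<exists>n\<in>N. n \<otimes> x \<in> A}"
proof -
  have "N #> x \<in> proj ` A \<longleftrightarrow> (\<exists>n\<in>N. n \<otimes> x \<in> A)" if x: "x \<in> carrier G" for x
  proof
    assume "N #> x \<in> proj ` A"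
    then obtain a where a: "a \<in> A" "N #> a = N #> x" by auto
    then show "\<exists>n\<in>N. n \<otimes> x \<in> A" using proj_eq_iff[of a x] assms x by auto
  next
    assume "\<exists>n\<in>N. n \<otimes> x \<in> A"
    then obtain n where n: "n \<in> N" "n \<otimes> x \<in> A" by auto
    then have "N #> (n \<otimes> x) = N #> x" using proj_eq_iff[of "n \<otimes> x" x] assms x by auto
    then show "N #> x \<in> proj ` A" using n by (metis image_eqI)
  qed
  then show ?thesis by (auto simp: topspace_eq_carrier)
qed

lemma open_map_proj: "open_map T quot_top proj"
  unfolding open_map_def openin_quotient_topology
proof (intro allI impI conjI)
  fix U assume U: "openin T U"
  then have sub: "U \<subseteq> carrier G" using openin_subset topspace_eq_carrier by metis
  then show "proj ` U \<subseteq> proj ` topspace T" by (auto simp: topspace_eq_carrier)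
  have "{x \<in> carrier G. \<exists>n\<in>N. n \<otimes> x \<in> U} = (\<Union>n\<in>N. {x \<in> carrier G. n \<otimes> x \<in> U})" by auto
  moreover have "openin T \<dots>" using openin_translate U by auto
  ultimately show "openin T {x \<in> topspace T. N #> x \<in> proj ` U}"
    using proj_saturation[OF sub] by simp
qed

text \<open>The saturation of a closed set is closed because projecting along the compact factor
  \<^term>\<open>N\<close> is a closed map.\<close>

lemma closed_map_proj: "closed_map T quot_top proj"
  unfolding closed_map_def
proof (intro allI impI)
  fix C assume C: "closedin T C"
  then have sub: "C \<subseteq> carrier G" using closedin_subset topspace_eq_carrier by metis
  let ?X = "prod_topology T (subtopology T N)"
  have "continuous_map ?X T (\<lambda>z. snd z \<otimes> fst z)"
    by (intro continuous_map_mult continuous_map_fst continuous_map_into_fulltopology[OF continuous_map_snd])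
  from closedin_continuous_map_preimage[OF this C]
  have "closedin T (fst ` {z \<in> topspace ?X. snd z \<otimes> fst z \<in> C})"
    using closed_map_fst[of "subtopology T N" T] compact by (simp add: closed_map_def compact_space_subtopology)
  moreover have "fst ` {z \<in> topspace ?X. snd z \<otimes> fst z \<in> C} = {x \<in> carrier G. \<exists>n\<in>N. n \<otimes> x \<in> C}"
    using subset by (force simp: topspace_eq_carrier image_iff)
  ultimately have "closedin T {x \<in> topspace T. N #> x \<in> proj ` C}"
    using proj_saturation[OF sub] by simp
  moreover have "proj ` C \<subseteq> topspace quot_top" using sub by (auto simp: topspace_eq_carrier)
  ultimately show "closedin quot_top (proj ` C)"
    using quotient_map_quotient_topology[of T proj] unfolding quotient_map_closedin by blast
qed

text \<open>Each fibre is a coset of \<open>N\<close>, hence the image of the compact set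
  \<open>N\<close> under a right translation.\<close>

lemma perfect_map_proj: "perfect_map T quot_top proj"
  unfolding perfect_map_def proper_map_def
proof (intro conjI ballI)
  show "continuous_map T quot_top proj"
    using quotient_map_quotient_topology quotient_imp_continuous_map by blast
  show "closed_map T quot_top proj" by (fact closed_map_proj)
  fix y assume "y \<in> topspace quot_top"
  then obtain a where a: "a \<in> carrier G" "y = N #> a" by (auto simp: topspace_eq_carrier)
  have "continuous_map T T (\<lambda>n. n \<otimes> a)"
    by (rule continuous_map_mult) (use a in \<open>auto simp: topspace_eq_carrier\<close>)
  then have "compactin T ((\<lambda>n. n \<otimes> a) ` N)" using compact image_compactin by blast
  moreover have "{x \<in> topspace T. N #> x = y} = (\<lambda>n. n \<otimes> a) ` N"
  proof -
    have "x \<in> carrier G \<and> N #> x = y \<longleftrightarrow> x \<in> (\<lambda>n. n \<otimes> a) ` N" for x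
    proof
      assume "x \<in> carrier G \<and> N #> x = y"
      then show "x \<in> (\<lambda>n. n \<otimes> a) ` N" using proj_eq_iff[of x a] a by blast
    next
      assume "x \<in> (\<lambda>n. n \<otimes> a) ` N"
      then have "x \<in> carrier G" "\<exists>n\<in>N. x = n \<otimes> a" using a by auto
      then show "x \<in> carrier G \<and> N #> x = y" using proj_eq_iff[of x a] a by blast
    qed
    then show ?thesis by (auto simp: topspace_eq_carrier)
  qed
  ultimately show "compactin T {x \<in> topspace T. N #> x = y}" by simp
qed simp

text \<open>The operations descend along quotient maps. For the Hausdorff property, the diagonal is
  the preimage of the identity coset under division, so it suffices that this one point is
  closed.\<close>

lemma topological_group_quotient: "topological_group (G Mod N) quot_top"
proof -
  interpret Q: group "G Mod N" by (rule factorgroup_is_group)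
  have cont: "continuous_map T quot_top proj"
    using perfect_map_proj perfect_map_def by blast
  have proj_hom: "group_hom G (G Mod N) proj"
    by (simp add: group_hom_def group_hom_axioms_def r_coset_hom_Mod Q.is_group is_group)
  have cm: "continuous_map (prod_topology quot_top quot_top) quot_top (\<lambda>(x, y). x \<otimes>\<^bsub>G Mod N\<^esub> y)"
  proof (rule continuous_compose_quotient_map)
    show "quotient_map (prod_topology T T) (prod_topology quot_top quot_top) (\<lambda>(x, y). (N #> x, N #> y))"
    proof (rule continuous_open_imp_quotient_map)
      show "continuous_map (prod_topology T T) (prod_topology quot_top quot_top) (\<lambda>(x, y). (N #> x, N #> y))"
        using cont by (simp add: continuous_map_prod_top)
      show "open_map (prod_topology T T) (prod_topology quot_top quot_top) (\<lambda>(x, y). (N #> x, N #> y))"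
        using open_map_map_prod open_map_proj by blast
    qed force
    show "continuous_map (prod_topology T T) quot_top
        ((\<lambda>(x, y). x \<otimes>\<^bsub>G Mod N\<^esub> y) \<circ> (\<lambda>(x, y). (N #> x, N #> y)))"
      by (rule continuous_map_eq[OF continuous_map_compose[OF continuous_mult cont]])
        (auto simp: topspace_eq_carrier rcos_sum)
  qed
  have ci: "continuous_map quot_top quot_top (\<lambda>x. inv\<^bsub>G Mod N\<^esub> x)"
  proof (rule continuous_compose_quotient_map[OF quotient_map_quotient_topology])
    show "continuous_map T quot_top ((\<lambda>x. inv\<^bsub>G Mod N\<^esub> x) \<circ> proj)"
      by (rule continuous_map_eq[OF continuous_map_compose[OF continuous_inv cont]])
        (simp add: topspace_eq_carrier group_hom.hom_inv[OF proj_hom])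
  qed
  \<comment> \<open>The identity coset is the image of a closed point under the closed map
    \<open>proj\<close>.\<close>
  have "closedin T {\<one>}" using Hausdorff by (simp add: closedin_Hausdorff_singleton topspace_eq_carrier)
  then have "closedin quot_top (proj ` {\<one>})" using closed_map_proj closed_map_def by blast
  then have one: "closedin quot_top {\<one>\<^bsub>G Mod N\<^esub>}"
    using subset coset_mult_one by simp
  have "continuous_map (prod_topology quot_top quot_top) quot_top (\<lambda>z. fst z \<otimes>\<^bsub>G Mod N\<^esub> inv\<^bsub>G Mod N\<^esub> (snd z))"
  proof -
    have "continuous_map (prod_topology quot_top quot_top) (prod_topology quot_top quot_top)
        (\<lambda>z. (fst z, inv\<^bsub>G Mod N\<^esub> (snd z)))"
      using continuous_map_compose[OF continuous_map_snd ci]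
      by (intro continuous_map_pairedI continuous_map_fst) (simp add: o_def)
    from continuous_map_compose[OF this cm] show ?thesis by (simp add: o_def case_prod_unfold del: mult_FactGroup)
  qed
  from closedin_continuous_map_preimage[OF this one]
  have "closedin (prod_topology quot_top quot_top)
    {z \<in> topspace (prod_topology quot_top quot_top). fst z \<otimes>\<^bsub>G Mod N\<^esub> inv\<^bsub>G Mod N\<^esub> (snd z) = \<one>\<^bsub>G Mod N\<^esub>}"
    by (simp del: mult_FactGroup one_FactGroup topspace_quotient_topology)
  moreover have "{z \<in> topspace (prod_topology quot_top quot_top). fst z \<otimes>\<^bsub>G Mod N\<^esub> inv\<^bsub>G Mod N\<^esub> (snd z) = \<one>\<^bsub>G Mod N\<^esub>}
    = (\<lambda>x. (x, x)) ` topspace quot_top"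
  proof -
    have "x \<otimes>\<^bsub>G Mod N\<^esub> inv\<^bsub>G Mod N\<^esub> y = \<one>\<^bsub>G Mod N\<^esub> \<longleftrightarrow> x = y"
      if "x \<in> carrier (G Mod N)" "y \<in> carrier (G Mod N)" for x y
      using that Q.inv_solve_right'[of "\<one>\<^bsub>G Mod N\<^esub>" x y] Q.l_one by (metis Q.one_closed)
    then show ?thesis
      unfolding topspace_prod_topology topspace_quot_top by (auto simp del: mult_FactGroup one_FactGroup)
  qed
  ultimately have "Hausdorff_space quot_top"
    unfolding Hausdorff_space_closedin_diagonal by simp
  then show ?thesis
    using cm ci topspace_quot_top Q.is_group
    by (simp add: topological_group_def topological_group_axioms_def)
qed

lemma perfect_hom_proj: "perfect_hom G T (G Mod N) quot_top proj"
  by (simp add: perfect_hom_def r_coset_hom_Mod perfect_map_proj)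

end

section \<open>Open images of factorizable groups\<close>

theorem theorem3p11:
  fixes G :: "('a, 'm) monoid_scheme" and T :: "'a topology"
    and H :: "('b, 'n) monoid_scheme" and S :: "'b topology"
    and f :: "'a \<Rightarrow> 'b"
  assumes "topological_group G T"
    and "PM_factorizable G T"
    and "topological_group H S"
    and "f \<in> epi G H"
    and "continuous_map T S f"
    and "open_map T S f"
  shows "PM_factorizable H S"
  unfolding PM_factorizable_def
proof (intro conjI allI impI)
  fix h :: "'b \<Rightarrow> real" assume h: "continuous_map S euclideanreal h"
  interpret G: topological_group G T by fact
  interpret H: topological_group H S by fact
  have f_onto: "f ` carrier G = carrier H" and f_hom: "f \<in> hom G H"
    using assms(4) by (auto simp: epi_def)
  interpret f: group_hom G H f
    by (simp add: group_hom_def group_hom_axioms_def f_hom G.is_group H.is_group)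
  have "continuous_map T euclideanreal (h \<circ> f)"
    using continuous_map_compose[OF assms(5) h] .
  from mp[OF spec[OF conjunct2[OF assms(2)[unfolded PM_factorizable_def]]] this]
  obtain M :: "'a set monoid" and R \<pi> g where M: "topological_group M R" "metrizable_space R"
    and \<pi>: "perfect_hom G T M R \<pi>" and g: "\<forall>x\<in>carrier G. (h \<circ> f) x = g (\<pi> x)"
    by (elim exE conjE)
  interpret M: topological_group M R by fact
  have \<pi>_perf: "perfect_map T R \<pi>" and \<pi>_hom: "\<pi> \<in> hom G M"
    using \<pi> by (auto simp: perfect_hom_def)
  interpret \<pi>: group_hom G M \<pi>
    by (simp add: group_hom_def group_hom_axioms_def \<pi>_hom G.is_group M.is_group)
  define K where "K = kernel G M \<pi>"
  define N where "N = f ` K"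
  \<comment> \<open>The kernel is the fibre of the perfect map \<open>\<pi>\<close> over the
    identity.\<close>
  have "compactin T K"
    using \<pi>_perf by (simp add: K_def kernel_def perfect_map_def proper_map_def
        G.topspace_eq_carrier M.topspace_eq_carrier)
  then have "compactin S N" unfolding N_def using assms(5) image_compactin by blast
  moreover have "N \<lhd> H"
    unfolding N_def K_def
    by (rule normal.surj_hom_normal_subgroup[OF \<pi>.normal_kernel f.group_hom_axioms f_onto])
  ultimately interpret Q: compact_normal_subgroup H S N
    by (simp add: compact_normal_subgroup_def compact_normal_subgroup_axioms_def H.topological_group_axioms)
  have K: "k \<in> carrier G" "\<pi> k = \<one>\<^bsub>M\<^esub>" if "k \<in> K" for k
    using that by (auto simp: K_def kernel_def)
  \<comment> \<open>Points with equal image under \<open>\<pi>\<close> differ by an element of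
    \<open>K\<close>, so their images under \<open>f\<close> differ by an element of
    \<open>N\<close>. Hence the map from \<open>G\<close> to the cosets of \<open>N\<close> is
    constant on the fibres of \<open>\<pi>\<close> and, \<open>\<pi>\<close> being a quotient map,
    induces a continuous \<open>\<rho>\<close> on \<open>M\<close>.\<close>
  have lift: "Q.proj (f x) = Q.proj (f y)"
    if x: "x \<in> topspace T" and y: "y \<in> topspace T" and eq: "\<pi> x = \<pi> y" for x y
  proof -
    have xy: "x \<in> carrier G" "y \<in> carrier G" using x y by (auto simp: G.topspace_eq_carrier)
    define k where "k = x \<otimes>\<^bsub>G\<^esub> inv\<^bsub>G\<^esub> y"
    have "k \<in> K" using xy eq by (simp add: k_def K_def kernel_def)
    moreover have "f x = f k \<otimes>\<^bsub>H\<^esub> f y" using xy by (simp add: k_def H.m_assoc)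
    ultimately show ?thesis using Q.proj_eq_iff xy by (auto simp: N_def)
  qed
  have proj_cont: "continuous_map S Q.quot_top Q.proj"
    using Q.perfect_map_proj perfect_map_def by blast
  have qf: "continuous_map T Q.quot_top (Q.proj \<circ> f)"
    using continuous_map_compose[OF assms(5) proj_cont] .
  from quotient_map_lift_exists[OF perfect_imp_quotient_map[OF \<pi>_perf] qf]
  obtain \<rho> where \<rho>: "continuous_map R Q.quot_top \<rho>"
    "\<rho> ` topspace R = (Q.proj \<circ> f) ` topspace T"
    "\<And>x. x \<in> topspace T \<Longrightarrow> \<rho> (\<pi> x) = (Q.proj \<circ> f) x"
    using lift by (metis comp_apply)
  \<comment> \<open>The composite agrees with \<open>Q.proj \<circ> f\<close>, which is open as a
    composite of open maps. Openness then passes to \<open>\<rho>\<close> because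
    \<open>\<pi>\<close> is continuous and onto.\<close>
  have "open_map T Q.quot_top (\<rho> \<circ> \<pi>)"
    unfolding open_map_def
  proof (intro allI impI)
    fix U assume U: "openin T U"
    then have "(\<rho> \<circ> \<pi>) ` U = (Q.proj \<circ> f) ` U"
      using \<rho>(3) openin_subset[OF U] by (intro image_cong) auto
    then show "openin Q.quot_top ((\<rho> \<circ> \<pi>) ` U)"
      using open_map_compose[OF assms(6) Q.open_map_proj] U by (simp add: open_map_def)
  qed
  then have "open_map R Q.quot_top \<rho>"
    by (rule open_map_from_composition_left) (use \<pi>_perf in \<open>auto simp: perfect_map_def\<close>)
  moreover have "\<rho> ` topspace R = topspace Q.quot_top"
    unfolding \<rho>(2) image_comp[symmetric] G.topspace_eq_carrier f_onto topspace_quotient_topology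
      H.topspace_eq_carrier ..
  \<comment> \<open>Metrizability itself need not survive open continuous images, but first
    countability does; the group structure of the quotient then restores metrizability.\<close>
  ultimately have "first_countable Q.quot_top"
    using first_countable_open_map_image[OF \<rho>(1)] metrizable_imp_first_countable[OF M(2)] by simp
  then have met: "metrizable_space Q.quot_top"
    by (rule topological_group.first_countable_imp_metrizable[OF Q.topological_group_quotient])
  have h_eq: "h a = h b" if a: "a \<in> topspace S" and b: "b \<in> topspace S" and eq: "N #>\<^bsub>H\<^esub> a = N #>\<^bsub>H\<^esub> b" for a b
  proof -
    have ab: "a \<in> carrier H" "b \<in> carrier H" using a b by (auto simp: H.topspace_eq_carrier)
    then obtain k where k: "k \<in> K" "a = f k \<otimes>\<^bsub>H\<^esub> b"
      using Q.proj_eq_iff[OF ab] eq by (auto simp: N_def)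
    obtain y where y: "y \<in> carrier G" "b = f y" using ab(2) f_onto by blast
    \<comment> \<open>Both \<open>a\<close> and \<open>b\<close> are lifted to \<open>G\<close> so
      that the lifts differ by an element of the kernel of \<open>\<pi>\<close>; the factorization
      of \<open>h \<circ> f\<close> through \<open>\<pi>\<close> then gives them the same value
      under \<open>h\<close>.\<close>
    have "a = f (k \<otimes>\<^bsub>G\<^esub> y)" using K k y by simp
    moreover have "\<pi> (k \<otimes>\<^bsub>G\<^esub> y) = \<pi> y" using K k y by simp
    ultimately show ?thesis using g K k y by (metis G.m_closed comp_apply)
  qed
  obtain g' where "continuous_map Q.quot_top euclideanreal g'" "\<And>x. x \<in> topspace S \<Longrightarrow> g' (N #>\<^bsub>H\<^esub> x) = h x"
    by (rule quotient_map_lift_exists[OF quotient_map_quotient_topology[of S Q.proj] h]) (use h_eq in blast)+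
  \<comment> \<open>The factor is \<open>H Mod N\<close>, whose elements are cosets and so have the
    type \<open>'b set\<close> that \<open>PM_factorizable\<close> prescribes.\<close>
  then show "\<exists>(L :: 'b set monoid) R \<pi> g.
        topological_group L R \<and> metrizable_space R \<and> perfect_hom H S L R \<pi> \<and>
        continuous_map R euclideanreal g \<and> (\<forall>x \<in> carrier H. h x = g (\<pi> x))"
    using Q.topological_group_quotient met Q.perfect_hom_proj H.topspace_eq_carrier
    by (intro exI[of _ "H Mod N"] exI[of _ Q.quot_top] exI[of _ Q.proj] exI[of _ g']) auto
qed (fact assms(3))

end
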